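(* For $t>0$, let $G_t(p,q)$ be the negative Green kernel on the annulus $\{z\in\mathbb C : e^{-2t}<|z|<e^{2t}\}$. Then $$\lim_{t\to+\infty}\left(G_t(p,q)+\log\left(e^t-e^{-t}\right)\right)=\log\frac{|p-q|}{\sqrt{|pq|}},$$ uniformly on each compact subset of $(\mathbb C\setminus\{0\})\times(\mathbb C\setminus\{0\})$.
   Context: The negative Green kernel on a bounded planar domain $A$ with smooth boundary is the function $G(p,q)$, $p,q\in A$, such that for each $q\in A$ the function $p\mapsto G(p,q)$ is harmonic on $A\setminus\{q\}$, $G(p,q)-\log|p-q|$ extends harmonically across $p=q$, and $G(p,q)\to0$ as $p\to\partial A$ (so $G\le 0$). On the diagonal $p=q$ both $G_t(p,q)$ and $\log\frac{|p-q|}{\sqrt{|pq|}}$ equal $-\infty$; uniform convergence is understood for the difference of the two sides, in which the singularity $\log|p-q|$ cancels (so the difference extends continuously across the diagonal). *)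

theory Defs
  imports "HOL-Analysis.Analysis"
begin

(* u is of class C^2 on the open set S and satisfies Laplace's equation there.  The functions
   ux, uy are the first partial derivatives with respect to x = Re z, y = Im z, and
   uxx, uxy, uyx, uyy the (continuous) second ones. *)
definition harmonic_on :: "(complex \<Rightarrow> real) \<Rightarrow> complex set \<Rightarrow> bool" where
  "harmonic_on u S \<longleftrightarrow> open S \<and>
     (\<exists>ux uy uxx uxy uyx uyy.
        (\<forall>z\<in>S. (u has_derivative (\<lambda>h. ux z * Re h + uy z * Im h)) (at z) \<and>
               (ux has_derivative (\<lambda>h. uxx z * Re h + uxy z * Im h)) (at z) \<and>
               (uy has_derivative (\<lambda>h. uyx z * Re h + uyy z * Im h)) (at z)) \<and>
        continuous_on S uxx \<and> continuous_on S uxy \<and>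
        continuous_on S uyx \<and> continuous_on S uyy \<and>
        (\<forall>z\<in>S. uxx z + uyy z = 0))"

(* The defining properties of the negative Green kernel of a bounded domain A.  They determine
   G p q for distinct p, q in A; the other values of the total function G are unconstrained
   (on the diagonal the kernel is -\<infinity>). *)
definition negative_green_kernel :: "complex set \<Rightarrow> (complex \<Rightarrow> complex \<Rightarrow> real) \<Rightarrow> bool" where
  "negative_green_kernel A G \<longleftrightarrow>
     (\<forall>q\<in>A.
        harmonic_on (\<lambda>p. G p q) (A - {q}) \<and>
        (\<exists>h. harmonic_on h A \<and> (\<forall>p\<in>A - {q}. h p = G p q - ln (cmod (p - q)))) \<and>
        (\<forall>\<xi>\<in>frontier A. ((\<lambda>p. G p q) \<longlongrightarrow> 0) (at \<xi> within A)))"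

definition annulus :: "real \<Rightarrow> complex set" where
  "annulus t = {z. exp (- 2 * t) < cmod z \<and> cmod z < exp (2 * t)}"

end

theory Submission
  imports Defs "HOL-Real_Asymp.Real_Asymp"
begin

text \<open>
  For a pole \<open>q\<close> in the annulus \<open>A\<^sub>t\<close> let \<open>h\<^sub>q\<close> be the regular part of the Green kernel, that is the
  harmonic extension of \<open>p \<mapsto> G\<^sub>t(p,q) - log |p - q|\<close> across \<open>p = q\<close>. It has the boundary values
  \<open>- log |\<xi> - q|\<close>. For large \<open>t\<close> these are close to \<open>- 2t\<close> on the outer circle, where \<open>q\<close> is
  negligible against \<open>\<xi>\<close>, and close to \<open>- log |q|\<close> on the inner circle, where \<open>\<xi>\<close> is negligible
  against \<open>q\<close>. The harmonic function of the form \<open>a + b log |p|\<close> with exactly these two constant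
  boundary values is
  \<open>- t - (log |q|) / 2 - (log |p|) / 2 + log |p| log |q| / (4t)\<close>.
  By the maximum principle it differs from \<open>h\<^sub>q\<close> by at most the boundary error, which is
  \<open>O(exp(- 2t))\<close> as long as \<open>|q|\<close> and \<open>1/|q|\<close> stay bounded (\<open>annulus_regular_part_estimate\<close>).
  Since \<open>log (exp t - exp (- t)) - t\<close> tends to \<open>0\<close>, and so does the last term for \<open>p\<close>, \<open>q\<close> in
  a compact subset of the punctured plane, the convergence follows.

  The difference of the two sides of the limit formula is \<open>h\<^sub>q(p)\<close> plus a function that is
  continuous in \<open>(p,q)\<close>. The joint continuity of \<open>h\<^sub>q(p)\<close> (\<open>green_regular_part_continuous\<close>) comes
  again from the maximum principle: the boundary values of \<open>h\<^sub>q - h\<^bsub>q'\<^esub>\<close> are uniformly small when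
  \<open>q\<close> is close to \<open>q'\<close>.

  The maximum principle holds for any bounded open set (\<open>harmonic_maximum_principle\<close>). It is proved
  by adding \<open>\<epsilon> |z|\<^sup>2\<close> to the harmonic function, which makes the Laplacian positive and so excludes
  interior maxima.
\<close>

section \<open>Harmonic functions\<close>

lemma harmonic_onI:
  assumes "open S"
    "\<And>z. z \<in> S \<Longrightarrow> (u has_derivative (\<lambda>h. ux z * Re h + uy z * Im h)) (at z)"
    "\<And>z. z \<in> S \<Longrightarrow> (ux has_derivative (\<lambda>h. uxx z * Re h + uxy z * Im h)) (at z)"
    "\<And>z. z \<in> S \<Longrightarrow> (uy has_derivative (\<lambda>h. uyx z * Re h + uyy z * Im h)) (at z)"
    "continuous_on S uxx" "continuous_on S uxy" "continuous_on S uyx" "continuous_on S uyy"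
    "\<And>z. z \<in> S \<Longrightarrow> uxx z + uyy z = 0"
  shows "harmonic_on u S"
  unfolding harmonic_on_def
  apply (rule conjI[OF assms(1)])
  apply (rule exI[of _ ux], rule exI[of _ uy], rule exI[of _ uxx], rule exI[of _ uxy],
      rule exI[of _ uyx], rule exI[of _ uyy])
  apply (intro conjI ballI assms; assumption)
  done

lemma harmonic_onE:
  assumes "harmonic_on u S"
  obtains ux uy uxx uxy uyx uyy where
    "open S"
    "\<forall>z\<in>S. (u has_derivative (\<lambda>h. ux z * Re h + uy z * Im h)) (at z)"
    "\<forall>z\<in>S. (ux has_derivative (\<lambda>h. uxx z * Re h + uxy z * Im h)) (at z)"
    "\<forall>z\<in>S. (uy has_derivative (\<lambda>h. uyx z * Re h + uyy z * Im h)) (at z)"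
    "continuous_on S uxx" "continuous_on S uxy" "continuous_on S uyx" "continuous_on S uyy"
    "\<forall>z\<in>S. uxx z + uyy z = 0"
  using assms unfolding harmonic_on_def ball_conj_distrib by (elim exE conjE) (rule that)

lemma harmonic_on_subset:
  assumes "harmonic_on u S" "open T" "T \<subseteq> S"
  shows "harmonic_on u T"
proof -
  obtain ux uy uxx uxy uyx uyy where u': "open S"
    "\<forall>z\<in>S. (u has_derivative (\<lambda>h. ux z * Re h + uy z * Im h)) (at z)"
    "\<forall>z\<in>S. (ux has_derivative (\<lambda>h. uxx z * Re h + uxy z * Im h)) (at z)"
    "\<forall>z\<in>S. (uy has_derivative (\<lambda>h. uyx z * Re h + uyy z * Im h)) (at z)"
    "continuous_on S uxx" "continuous_on S uxy" "continuous_on S uyx" "continuous_on S uyy"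
    "\<forall>z\<in>S. uxx z + uyy z = 0"
    using assms(1) by (rule harmonic_onE)
  note u = u'[rule_format]
  show ?thesis
    by (rule harmonic_onI[OF assms(2), of u ux uy uxx uxy uyx uyy])
      (use u assms(3) in \<open>auto intro: continuous_on_subset\<close>)
qed

lemma harmonic_on_imp_continuous_on:
  assumes "harmonic_on u S"
  shows "continuous_on S u"
proof (rule continuous_at_imp_continuous_on, rule ballI)
  fix z assume "z \<in> S"
  then obtain u' where "(u has_derivative u') (at z)"
    using assms unfolding harmonic_on_def by blast
  then show "isCont u z" by (rule has_derivative_continuous)
qed

lemma harmonic_on_const: "open S \<Longrightarrow> harmonic_on (\<lambda>_. c) S"
  by (rule harmonic_onI[of S _ "\<lambda>_. 0" "\<lambda>_. 0" "\<lambda>_. 0" "\<lambda>_. 0" "\<lambda>_. 0" "\<lambda>_. 0"]) auto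

lemma harmonic_on_linear_combination:
  assumes "harmonic_on u S" "harmonic_on v S"
  shows "harmonic_on (\<lambda>z. a * u z + b * v z) S"
proof -
  obtain ux uy uxx uxy uyx uyy where u': "open S"
    "\<forall>z\<in>S. (u has_derivative (\<lambda>h. ux z * Re h + uy z * Im h)) (at z)"
    "\<forall>z\<in>S. (ux has_derivative (\<lambda>h. uxx z * Re h + uxy z * Im h)) (at z)"
    "\<forall>z\<in>S. (uy has_derivative (\<lambda>h. uyx z * Re h + uyy z * Im h)) (at z)"
    "continuous_on S uxx" "continuous_on S uxy" "continuous_on S uyx" "continuous_on S uyy"
    "\<forall>z\<in>S. uxx z + uyy z = 0"
    using assms(1) by (rule harmonic_onE)
  note u = u'[rule_format]
  obtain vx vy vxx vxy vyx vyy where v': "open S"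
    "\<forall>z\<in>S. (v has_derivative (\<lambda>h. vx z * Re h + vy z * Im h)) (at z)"
    "\<forall>z\<in>S. (vx has_derivative (\<lambda>h. vxx z * Re h + vxy z * Im h)) (at z)"
    "\<forall>z\<in>S. (vy has_derivative (\<lambda>h. vyx z * Re h + vyy z * Im h)) (at z)"
    "continuous_on S vxx" "continuous_on S vxy" "continuous_on S vyx" "continuous_on S vyy"
    "\<forall>z\<in>S. vxx z + vyy z = 0"
    using assms(2) by (rule harmonic_onE)
  note v = v'[rule_format]
  have comb: "((\<lambda>z. a * f z + b * g z) has_derivative
      (\<lambda>h. (a * f1 z + b * g1 z) * Re h + (a * f2 z + b * g2 z) * Im h)) (at z)"
    if "(f has_derivative (\<lambda>h. f1 z * Re h + f2 z * Im h)) (at z)"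
       "(g has_derivative (\<lambda>h. g1 z * Re h + g2 z * Im h)) (at z)"
    for f g f1 f2 g1 g2 :: "complex \<Rightarrow> real" and z
    by (rule derivative_eq_intros that refl | simp add: algebra_simps)+
  have "a * uxx z + b * vxx z + (a * uyy z + b * vyy z) = 0" if "z \<in> S" for z
  proof -
    have "a * uxx z + b * vxx z + (a * uyy z + b * vyy z) = a * (uxx z + uyy z) + b * (vxx z + vyy z)"
      by (simp add: algebra_simps)
    then show ?thesis using u(9) v(9) that by simp
  qed
  then show ?thesis
    by (intro harmonic_onI[of S _ "\<lambda>z. a * ux z + b * vx z" "\<lambda>z. a * uy z + b * vy z"
          "\<lambda>z. a * uxx z + b * vxx z" "\<lambda>z. a * uxy z + b * vxy z"
          "\<lambda>z. a * uyx z + b * vyx z" "\<lambda>z. a * uyy z + b * vyy z"]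
        u(1) comb u(2-8) v(2-8) continuous_on_add continuous_on_mult_left)
qed

lemma has_derivative_quotient_norm_sq:
  assumes "z \<noteq> 0" "(f has_derivative f') (at z)"
  shows "((\<lambda>w. f w / ((Re w)\<^sup>2 + (Im w)\<^sup>2)) has_derivative
    (\<lambda>h. f' h / ((Re z)\<^sup>2 + (Im z)\<^sup>2)
        - f z * (2 * Re z * Re h + 2 * Im z * Im h) / ((Re z)\<^sup>2 + (Im z)\<^sup>2)\<^sup>2)) (at z)"
proof -
  have nz: "(Re z)\<^sup>2 + (Im z)\<^sup>2 \<noteq> 0"
    using assms by (metis complex_eq_iff sum_power2_eq_zero_iff zero_complex.sel)
  show ?thesis
    apply (rule derivative_eq_intros assms(2) refl nz | simp)+
    using nz by (auto simp: field_simps power2_eq_square)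
qed

lemma harmonic_on_ln_norm: "harmonic_on (\<lambda>z. ln (cmod z)) (- {0})"
proof -
  define N where "N = (\<lambda>z. (Re z)\<^sup>2 + (Im z)\<^sup>2)"
  have N: "N z \<noteq> 0" if "z \<noteq> 0" for z
    using that unfolding N_def by (metis complex_eq_iff sum_power2_eq_zero_iff zero_complex.sel)
  have Npos: "N z > 0" if "z \<noteq> 0" for z
    using N[OF that] unfolding N_def by (metis less_le sum_power2_ge_zero)
  have 0: "((\<lambda>z. ln (cmod z)) has_derivative (\<lambda>h. Re z / N z * Re h + Im z / N z * Im h)) (at z)"
    if "z \<noteq> 0" for z
  proof -
    have dN: "(N has_derivative (\<lambda>h. 2 * Re z * Re h + 2 * Im z * Im h)) (at z)"
      unfolding N_def by (rule derivative_eq_intros refl | simp add: algebra_simps)+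
    have "((\<lambda>z. ln (N z) / 2) has_derivative
        (\<lambda>h. Re z / N z * Re h + Im z / N z * Im h)) (at z)"
      by (rule derivative_eq_intros dN Npos[OF that] refl | simp)+
        (use Npos[OF that] in \<open>auto simp: field_simps fun_eq_iff\<close>)
    moreover have "ln (cmod w) = ln (N w) / 2" for w
      by (cases "w = 0") (use Npos[of w] in \<open>auto simp: cmod_def N_def ln_sqrt\<close>)
    ultimately show ?thesis by (simp only:)
  qed
  have 1: "((\<lambda>z. Re z / N z) has_derivative
      (\<lambda>h. ((Im z)\<^sup>2 - (Re z)\<^sup>2) / (N z)\<^sup>2 * Re h + (- 2 * Re z * Im z / (N z)\<^sup>2) * Im h)) (at z)"
    if "z \<noteq> 0" for z
  proof -
    \<comment> \<open>Brings all terms to the denominator \<open>(N z)\<^sup>2\<close>.\<close>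
    have eq: "x / N z = x * N z / (N z)\<^sup>2" for x using N[OF that] by (simp add: power2_eq_square)
    show ?thesis
      unfolding N_def
      apply (rule has_derivative_eq_rhs[OF has_derivative_quotient_norm_sq[OF that]])
       apply (rule derivative_eq_intros refl)+
      apply (rule ext)
      unfolding N_def[symmetric, THEN fun_cong] eq
      apply (simp add: N_def add_divide_distrib[symmetric] diff_divide_distrib[symmetric])
      apply (simp add: algebra_simps power2_eq_square)
      done
  qed
  have 2: "((\<lambda>z. Im z / N z) has_derivative
      (\<lambda>h. (- 2 * Re z * Im z / (N z)\<^sup>2) * Re h + ((Re z)\<^sup>2 - (Im z)\<^sup>2) / (N z)\<^sup>2 * Im h)) (at z)"
    if "z \<noteq> 0" for z
  proof -
    \<comment> \<open>Brings all terms to the denominator \<open>(N z)\<^sup>2\<close>.\<close>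
    have eq: "x / N z = x * N z / (N z)\<^sup>2" for x using N[OF that] by (simp add: power2_eq_square)
    show ?thesis
      unfolding N_def
      apply (rule has_derivative_eq_rhs[OF has_derivative_quotient_norm_sq[OF that]])
       apply (rule derivative_eq_intros refl)+
      apply (rule ext)
      unfolding N_def[symmetric, THEN fun_cong] eq
      apply (simp add: N_def add_divide_distrib[symmetric] diff_divide_distrib[symmetric])
      apply (simp add: algebra_simps power2_eq_square)
      done
  qed
  have cont: "continuous_on (- {0}) (\<lambda>z. f z / (N z)\<^sup>2)" if "continuous_on (- {0}) f" for f
    using N that by (intro continuous_intros) (auto simp: N_def intro!: continuous_intros)
  show ?thesis
    by (rule harmonic_onI[of _ _ "\<lambda>z. Re z / N z" "\<lambda>z. Im z / N z"
          "\<lambda>z. ((Im z)\<^sup>2 - (Re z)\<^sup>2) / (N z)\<^sup>2" "\<lambda>z. - 2 * Re z * Im z / (N z)\<^sup>2"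
          "\<lambda>z. - 2 * Re z * Im z / (N z)\<^sup>2" "\<lambda>z. ((Re z)\<^sup>2 - (Im z)\<^sup>2) / (N z)\<^sup>2"])
      ((rule 0 1 2, simp; fail) | (intro cont continuous_intros) |
        simp add: open_Compl diff_divide_distrib)+
qed

section \<open>The maximum principle\<close>

text \<open>The one-dimensional second derivative test at an interior maximum.\<close>
lemma deriv_at_max_second_deriv_nonpos:
  fixes f f' :: "real \<Rightarrow> real"
  assumes d: "d > 0"
    and f: "\<And>s. \<bar>s\<bar> < d \<Longrightarrow> (f has_real_derivative f' s) (at s)"
    and f': "(f' has_real_derivative c) (at 0)"
    and max: "\<And>s. \<bar>s\<bar> < d \<Longrightarrow> f s \<le> f 0"
  shows "c \<le> 0"
proof (rule ccontr)
  assume "\<not> c \<le> 0"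
  then have "c > 0" by simp
  have f'0: "f' 0 = 0"
    by (rule DERIV_local_max[OF f d]) (use d max in auto)
  obtain e where e: "e > 0" "\<And>s. 0 < s \<Longrightarrow> s < e \<Longrightarrow> f' 0 < f' s"
    using DERIV_pos_inc_right[OF f' \<open>c > 0\<close>] by auto
  define s where "s = min d e / 2"
  have s: "0 < s" "s < d" "s < e" using d e by (auto simp: s_def)
  obtain r where r: "0 < r" "r < s" "f s - f 0 = (s - 0) * f' r"
    using MVT2[of 0 s f f'] f s by force
  have "f' r > 0" using e(2)[of r] r s f'0 by auto
  then have "f s > f 0" using r s by (smt (verit) mult_pos_pos)
  then show False using max[of s] s by auto
qed

lemma has_real_derivative_along_line:
  assumes "\<forall>w\<in>S. (f has_derivative (\<lambda>h. fx w * Re h + fy w * Im h)) (at w)"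
    and "z + of_real s * e \<in> S"
  shows "((\<lambda>s. f (z + of_real s * e)) has_real_derivative
    fx (z + of_real s * e) * Re e + fy (z + of_real s * e) * Im e) (at s)"
proof -
  have "((\<lambda>s. z + of_real s * e) has_derivative (\<lambda>h. of_real h * e)) (at s)"
    by (intro derivative_eq_intros) auto
  from diff_chain_at[OF this assms(1)[rule_format, OF assms(2)]] show ?thesis
    unfolding has_field_derivative_def o_def
    by (rule has_derivative_eq_rhs) (auto simp: algebra_simps)
qed

text \<open>
  Boundary values are imposed only as limits from inside \<open>A\<close>, so \<open>u\<close> need not be defined in a
  meaningful way outside \<open>A\<close>.
\<close>
theorem harmonic_maximum_principle:
  assumes u: "harmonic_on u A" and "bounded A"
    and bd: "\<And>\<xi>. \<xi> \<in> frontier A \<Longrightarrow> \<exists>l\<le>M. (u \<longlongrightarrow> l) (at \<xi> within A)"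
    and p0: "p0 \<in> A"
  shows "u p0 \<le> M"
proof (rule ccontr)
  assume "\<not> u p0 \<le> M"
  then have gt: "u p0 > M" by simp
  have "open A" using u by (simp add: harmonic_on_def)
  obtain R where R: "R > 0" "\<And>z. z \<in> closure A \<Longrightarrow> cmod z \<le> R"
    using bounded_closure[OF \<open>bounded A\<close>] by (auto simp: bounded_pos)
  \<comment> \<open>Small enough for the boundary values of \<open>u + \<epsilon> |z|\<^sup>2\<close> to stay below \<open>u p0\<close>.\<close>
  define \<epsilon> where "\<epsilon> = (u p0 - M) / (2 * R\<^sup>2)"
  have \<epsilon>: "\<epsilon> > 0" using gt R by (simp add: \<epsilon>_def)
  have \<epsilon>R: "M + \<epsilon> * R\<^sup>2 < u p0" using gt R by (simp add: \<epsilon>_def field_simps)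
  define v where "v = (\<lambda>z. u z + \<epsilon> * (cmod z)\<^sup>2)"
  have contv: "continuous_on A v"
    unfolding v_def by (intro continuous_intros harmonic_on_imp_continuous_on u)
  \<comment> \<open>This superlevel set stays away from the frontier, hence it is compact and \<open>v\<close> attains its
    maximum over \<open>A\<close> on it.\<close>
  define K where "K = {z \<in> A. v p0 \<le> v z}"
  have "closed K"
    unfolding closed_limpt
  proof safe
    fix \<xi> assume lim: "\<xi> islimpt K"
    then have nt: "at \<xi> within K \<noteq> bot" by (simp add: trivial_limit_within)
    have ev: "\<forall>\<^sub>F z in at \<xi> within K. v p0 \<le> v z"
      by (auto simp: eventually_at_filter K_def)
    have "\<xi> islimpt A" using lim by (rule islimpt_subset) (auto simp: K_def)
    then have cl: "\<xi> \<in> closure A" by (simp add: closure_def)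
    show "\<xi> \<in> K"
    proof (cases "\<xi> \<in> A")
      case True
      then have "(v \<longlongrightarrow> v \<xi>) (at \<xi> within A)" using contv by (simp add: continuous_on_def)
      then have "(v \<longlongrightarrow> v \<xi>) (at \<xi> within K)"
        by (rule tendsto_within_subset) (auto simp: K_def)
      then have "v p0 \<le> v \<xi>" using ev nt by (rule tendsto_lowerbound)
      then show ?thesis using True by (simp add: K_def)
    next
      case False
      then have "\<xi> \<in> frontier A" using cl \<open>open A\<close> by (simp add: frontier_def interior_open)
      then obtain l where l: "l \<le> M" "(u \<longlongrightarrow> l) (at \<xi> within A)" using bd by blast
      have "(v \<longlongrightarrow> l + \<epsilon> * (cmod \<xi>)\<^sup>2) (at \<xi> within A)"
        unfolding v_def by (intro tendsto_intros l)
      then have "(v \<longlongrightarrow> l + \<epsilon> * (cmod \<xi>)\<^sup>2) (at \<xi> within K)"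
        by (rule tendsto_within_subset) (auto simp: K_def)
      then have "v p0 \<le> l + \<epsilon> * (cmod \<xi>)\<^sup>2" using ev nt by (rule tendsto_lowerbound)
      also have "\<dots> \<le> M + \<epsilon> * R\<^sup>2"
        using l R(2)[OF cl] \<epsilon> by (intro add_mono mult_left_mono power_mono) auto
      also have "\<dots> < v p0" using \<epsilon>R mult_nonneg_nonneg[of \<epsilon> "(cmod p0)\<^sup>2"] \<epsilon>
        by (simp add: v_def del: mult_nonneg_nonneg)
      finally show ?thesis by simp
    qed
  qed
  moreover have "bounded K" using \<open>bounded A\<close> by (rule bounded_subset) (auto simp: K_def)
  ultimately have "compact K" by (simp add: compact_eq_bounded_closed)
  moreover have "K \<noteq> {}" using p0 by (auto simp: K_def)
  moreover have "continuous_on K v" using contv by (rule continuous_on_subset) (auto simp: K_def)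
  ultimately obtain z where z: "z \<in> K" "\<And>y. y \<in> K \<Longrightarrow> v y \<le> v z"
    using continuous_attains_sup[of K v] by blast
  have zA: "z \<in> A" using z by (simp add: K_def)
  have max: "v y \<le> v z" if "y \<in> A" for y
    using z that by (cases "y \<in> K") (auto simp: K_def)
  obtain d where d: "d > 0" "ball z d \<subseteq> A" using \<open>open A\<close> zA by (meson openE)
  obtain ux uy uxx uxy uyx uyy where "open A" and U:
    "\<forall>z\<in>A. (u has_derivative (\<lambda>h. ux z * Re h + uy z * Im h)) (at z)"
    "\<forall>z\<in>A. (ux has_derivative (\<lambda>h. uxx z * Re h + uxy z * Im h)) (at z)"
    "\<forall>z\<in>A. (uy has_derivative (\<lambda>h. uyx z * Re h + uyy z * Im h)) (at z)"
    "continuous_on A uxx" "continuous_on A uxy" "continuous_on A uyx" "continuous_on A uyy"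
    "\<forall>z\<in>A. uxx z + uyy z = 0"
    using u by (rule harmonic_onE)
  have inA: "z + of_real s * e \<in> A" if "\<bar>s\<bar> < d" "cmod e = 1" for s e
    using that d by (auto simp: subset_iff dist_norm norm_mult)
  have sq: "(cmod (z + of_real s * e))\<^sup>2 = (Re z + s * Re e)\<^sup>2 + (Im z + s * Im e)\<^sup>2" for s e
    by (simp add: cmod_power2)
  \<comment> \<open>Second derivative of \<open>v\<close> at the maximum \<open>z\<close> in a unit direction \<open>e\<close>.\<close>
  have second: "uxx z * (Re e)\<^sup>2 + (uxy z + uyx z) * Re e * Im e + uyy z * (Im e)\<^sup>2 + 2 * \<epsilon> \<le> 0"
    if e: "cmod e = 1" for e
  proof (rule deriv_at_max_second_deriv_nonpos[OF d(1)])
    have e2: "(Re e)\<^sup>2 + (Im e)\<^sup>2 = 1" using e cmod_power2[of e] by simp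
    let ?sq' = "\<lambda>s. \<epsilon> * (2 * (Re z + s * Re e) * Re e + 2 * (Im z + s * Im e) * Im e)"
    have sq': "((\<lambda>s. \<epsilon> * ((Re z + s * Re e)\<^sup>2 + (Im z + s * Im e)\<^sup>2)) has_real_derivative ?sq' s) (at s)" for s
      by (rule derivative_eq_intros refl | simp add: algebra_simps)+
    have sq'': "(?sq' has_real_derivative 2 * \<epsilon>) (at 0)"
    proof -
      have "(?sq' has_real_derivative \<epsilon> * (2 * ((Re e)\<^sup>2 + (Im e)\<^sup>2))) (at 0)"
        by (rule derivative_eq_intros refl | simp)+ (simp add: power2_eq_square algebra_simps)
      then show ?thesis by (simp only: e2) (simp add: mult.commute)
    qed
    show "((\<lambda>s. v (z + of_real s * e)) has_real_derivative
        (ux (z + of_real s * e) * Re e + uy (z + of_real s * e) * Im e) + ?sq' s) (at s)"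
      if "\<bar>s\<bar> < d" for s
      unfolding v_def sq
      by (rule DERIV_add[OF has_real_derivative_along_line[OF U(1) inA[OF that e]] sq'])
    have "((\<lambda>s. ux (z + of_real s * e)) has_real_derivative uxx z * Re e + uxy z * Im e) (at 0)"
      using has_real_derivative_along_line[OF U(2) inA[of 0 e]] d e by simp
    moreover have "((\<lambda>s. uy (z + of_real s * e)) has_real_derivative uyx z * Re e + uyy z * Im e) (at 0)"
      using has_real_derivative_along_line[OF U(3) inA[of 0 e]] d e by simp
    ultimately have "((\<lambda>s. (ux (z + of_real s * e) * Re e + uy (z + of_real s * e) * Im e) + ?sq' s) has_real_derivative
        ((uxx z * Re e + uxy z * Im e) * Re e + (uyx z * Re e + uyy z * Im e) * Im e) + 2 * \<epsilon>) (at 0)"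
      by (intro DERIV_add DERIV_cmult_right sq'')
    then show "((\<lambda>s. (ux (z + of_real s * e) * Re e + uy (z + of_real s * e) * Im e) + ?sq' s) has_real_derivative
        uxx z * (Re e)\<^sup>2 + (uxy z + uyx z) * Re e * Im e + uyy z * (Im e)\<^sup>2 + 2 * \<epsilon>) (at 0)"
      by (rule DERIV_cong) (simp add: algebra_simps power2_eq_square)
    show "v (z + of_real s * e) \<le> v (z + of_real 0 * e)" if "\<bar>s\<bar> < d" for s
      using max inA[OF that e] by simp
  qed
  \<comment> \<open>Adding the two coordinate directions contradicts Laplace's equation.\<close>
  have "uxx z + 2 * \<epsilon> \<le> 0" "uyy z + 2 * \<epsilon> \<le> 0"
    using second[of 1] second[of \<i>] by simp_all
  then show False using bspec[OF U(8) zA] \<epsilon> by linarith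
qed

corollary harmonic_abs_maximum_principle:
  assumes u: "harmonic_on u A" and "bounded A"
    and bd: "\<And>\<xi>. \<xi> \<in> frontier A \<Longrightarrow> (u \<longlongrightarrow> g \<xi>) (at \<xi> within A)"
    and g: "\<And>\<xi>. \<xi> \<in> frontier A \<Longrightarrow> \<bar>g \<xi>\<bar> \<le> M"
    and p: "p \<in> A"
  shows "\<bar>u p\<bar> \<le> M"
proof -
  have "u p \<le> M"
    using harmonic_maximum_principle[OF u \<open>bounded A\<close> _ p] bd g by (meson abs_le_D1)
  moreover have "harmonic_on (\<lambda>z. - u z) A"
    using harmonic_on_linear_combination[OF u u, of "-1" 0] by simp
  then have "- u p \<le> M"
  proof (rule harmonic_maximum_principle[OF _ \<open>bounded A\<close> _ p])
    fix \<xi> assume \<xi>: "\<xi> \<in> frontier A"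
    show "\<exists>l\<le>M. ((\<lambda>z. - u z) \<longlongrightarrow> l) (at \<xi> within A)"
      using tendsto_minus[OF bd[OF \<xi>]] g[OF \<xi>] by (intro exI[of _ "- g \<xi>"]) auto
  qed
  ultimately show ?thesis by simp
qed

section \<open>The regular part of a Green kernel\<close>

lemma abs_ln_norm_one_minus_le:
  assumes "cmod z \<le> 1 / 2"
  shows "\<bar>ln (cmod (1 - z))\<bar> \<le> 2 * cmod z"
proof -
  define x where "x = cmod z"
  have x: "0 \<le> x" "x \<le> 1 / 2" using assms by (auto simp: x_def)
  have lo: "1 - x \<le> cmod (1 - z)" unfolding x_def using norm_triangle_ineq2[of 1 z] by simp
  have hi: "cmod (1 - z) \<le> 1 + x" unfolding x_def using norm_triangle_ineq4[of 1 z] by simp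
  have "ln (cmod (1 - z)) \<le> ln (1 + x)" using lo hi x by (subst ln_le_cancel_iff) linarith+
  also have "\<dots> \<le> x" using x by (simp add: ln_add_one_self_le_self)
  finally have 1: "ln (cmod (1 - z)) \<le> 2 * x" using x by simp
  have "x * x \<le> x * (1/2)" using x by (intro mult_left_mono) auto
  then have "- (2 * x) \<le> - x - 2 * x\<^sup>2" by (simp add: power2_eq_square)
  also have "\<dots> \<le> ln (1 - x)" using ln_one_minus_pos_lower_bound x by blast
  also have "\<dots> \<le> ln (cmod (1 - z))" using lo x by (subst ln_le_cancel_iff) linarith+
  finally show ?thesis using 1 by (simp add: x_def)
qed

lemma abs_ln_norm_diff_le:
  assumes "b \<noteq> 0" "cmod a \<le> cmod b / 2"
  shows "\<bar>ln (cmod (b - a)) - ln (cmod b)\<bar> \<le> 2 * cmod a / cmod b"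
proof -
  have small: "cmod (a / b) \<le> 1 / 2" using assms by (simp add: norm_divide field_simps)
  then have nz: "1 - a / b \<noteq> 0" by auto
  have "b - a = b * (1 - a / b)" using assms by (simp add: field_simps)
  then have "ln (cmod (b - a)) = ln (cmod b) + ln (cmod (1 - a / b))"
    using nz assms(1) by (simp only: norm_mult) (simp add: ln_mult)
  then show ?thesis using abs_ln_norm_one_minus_le[OF small] by (simp add: norm_divide)
qed

text \<open>
  The regular part of the kernel \<open>G\<close> with pole \<open>q\<close>: a harmonic function on \<open>A\<close> that agrees with
  \<open>G(p,q) - log |p - q|\<close> for \<open>p \<noteq> q\<close>. The choice operator only serves to name it: by continuity
  there is at most one such function on \<open>A\<close>. Values outside \<open>A\<close> are irrelevant.
\<close>
definition green_regular_part ::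
    "complex set \<Rightarrow> (complex \<Rightarrow> complex \<Rightarrow> real) \<Rightarrow> complex \<Rightarrow> complex \<Rightarrow> real" where
  "green_regular_part A G q = (SOME h. harmonic_on h A \<and> (\<forall>p\<in>A - {q}. h p = G p q - ln (cmod (p - q))))"

lemma
  assumes "negative_green_kernel A G" "q \<in> A"
  shows green_regular_part_harmonic: "harmonic_on (green_regular_part A G q) A"
    and green_regular_part_eq: "\<And>p. p \<in> A \<Longrightarrow> p \<noteq> q \<Longrightarrow>
      green_regular_part A G q p = G p q - ln (cmod (p - q))"
proof -
  have "\<exists>h. harmonic_on h A \<and> (\<forall>p\<in>A - {q}. h p = G p q - ln (cmod (p - q)))"
    using assms unfolding negative_green_kernel_def by blast
  from someI_ex[OF this] show "harmonic_on (green_regular_part A G q) A"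
    "\<And>p. p \<in> A \<Longrightarrow> p \<noteq> q \<Longrightarrow> green_regular_part A G q p = G p q - ln (cmod (p - q))"
    unfolding green_regular_part_def by auto
qed

lemma green_regular_part_boundary:
  assumes G: "negative_green_kernel A G" and q: "q \<in> A" and \<xi>: "\<xi> \<in> frontier A"
  shows "(green_regular_part A G q \<longlongrightarrow> - ln (cmod (\<xi> - q))) (at \<xi> within A)"
proof -
  have "open A" using green_regular_part_harmonic[OF G q] by (simp add: harmonic_on_def)
  then have ne: "\<xi> \<noteq> q" using q \<xi> by (auto simp: frontier_def interior_open)
  have "((\<lambda>p. G p q) \<longlongrightarrow> 0) (at \<xi> within A)"
    using G q \<xi> unfolding negative_green_kernel_def by blast
  then have "((\<lambda>p. G p q - ln (cmod (p - q))) \<longlongrightarrow> 0 - ln (cmod (\<xi> - q))) (at \<xi> within A)"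
    using ne by (intro tendsto_intros) auto
  moreover have "\<forall>\<^sub>F p in at \<xi> within A. G p q - ln (cmod (p - q)) = green_regular_part A G q p"
  proof -
    have "\<forall>\<^sub>F p in at \<xi> within A. p \<noteq> q"
      using ne by (intro tendsto_imp_eventually_ne[OF tendsto_ident_at]) 
    moreover have "\<forall>\<^sub>F p in at \<xi> within A. p \<in> A" by (auto simp: eventually_at_filter)
    ultimately show ?thesis
      by eventually_elim (simp add: green_regular_part_eq[OF G q])
  qed
  ultimately show ?thesis by (auto intro: Lim_transform_eventually)
qed

text \<open>
  Joint continuity in both variables. The maximum principle bounds \<open>h\<^sub>q - h\<^bsub>q0\<^esub>\<close> uniformly on \<open>A\<close>
  by a multiple of \<open>|q - q0|\<close> for \<open>q\<close> near \<open>q0\<close>, so continuity in \<open>p\<close> of the single function \<open>h\<^bsub>q0\<^esub>\<close> suffices.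
\<close>
theorem green_regular_part_continuous:
  assumes G: "negative_green_kernel A G" and "bounded A"
  shows "continuous_on (A \<times> A) (\<lambda>(p, q). green_regular_part A G q p)"
proof -
  let ?h = "green_regular_part A G"
  have "\<exists>d>0. \<forall>x\<in>A \<times> A. dist x (p0, q0) < d \<longrightarrow>
      dist ((\<lambda>(p, q). ?h q p) x) (?h q0 p0) < e"
    if p0: "p0 \<in> A" and q0: "q0 \<in> A" and e: "e > 0" for p0 q0 e
  proof -
    have hq0: "harmonic_on (?h q0) A" by (rule green_regular_part_harmonic[OF G q0])
    then have "open A" by (simp add: harmonic_on_def)
    then obtain r where r: "r > 0" "ball q0 r \<subseteq> A" using q0 by (meson openE)
    have far: "r \<le> cmod (\<xi> - q0)" if "\<xi> \<in> frontier A" for \<xi>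
    proof -
      have "\<xi> \<notin> ball q0 r" using that r(2) \<open>open A\<close> by (auto simp: frontier_def interior_open)
      then show ?thesis by (simp add: dist_norm norm_minus_commute)
    qed
    have near: "\<bar>?h q p - ?h q0 p\<bar> \<le> 2 * cmod (q - q0) / r"
      if q: "q \<in> A" "cmod (q - q0) \<le> r / 2" and p: "p \<in> A" for p q
    proof -
      have "harmonic_on (\<lambda>p. ?h q p - ?h q0 p) A"
        using harmonic_on_linear_combination[OF green_regular_part_harmonic[OF G q(1)] hq0, of 1 "-1"]
        by simp
      then show ?thesis
      proof (rule harmonic_abs_maximum_principle[OF _ \<open>bounded A\<close> _ _ p])
        fix \<xi> assume \<xi>: "\<xi> \<in> frontier A"
        show "((\<lambda>p. ?h q p - ?h q0 p) \<longlongrightarrow> - ln (cmod (\<xi> - q)) - (- ln (cmod (\<xi> - q0)))) (at \<xi> within A)"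
          by (intro tendsto_diff green_regular_part_boundary[OF G _ \<xi>] q q0)
        have "\<xi> - q0 \<noteq> 0" "cmod (q - q0) \<le> cmod (\<xi> - q0) / 2"
          using far[OF \<xi>] r q by auto
        from abs_ln_norm_diff_le[OF this]
        have "\<bar>- ln (cmod (\<xi> - q)) - (- ln (cmod (\<xi> - q0)))\<bar> \<le> 2 * cmod (q - q0) / cmod (\<xi> - q0)"
          by simp
        also have "\<dots> \<le> 2 * cmod (q - q0) / r"
          using far[OF \<xi>] r by (intro divide_left_mono mult_pos_pos) auto
        finally show "\<bar>- ln (cmod (\<xi> - q)) - (- ln (cmod (\<xi> - q0)))\<bar> \<le> 2 * cmod (q - q0) / r" .
      qed
    qed
    obtain d1 where d1: "d1 > 0" "\<And>p. p \<in> A \<Longrightarrow> dist p p0 < d1 \<Longrightarrow> dist (?h q0 p) (?h q0 p0) < e / 2"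
      using harmonic_on_imp_continuous_on[OF hq0] p0 e unfolding continuous_on_iff
      by (metis half_gt_zero)
    define d where "d = Min {d1, r / 2, r * e / 4}"
    have d: "d > 0" "d \<le> d1" "d \<le> r / 2" "d \<le> r * e / 4" using d1 r e by (auto simp: d_def)
    show ?thesis
    proof (intro exI[of _ d] conjI ballI impI d(1))
      fix x assume x: "x \<in> A \<times> A" "dist x (p0, q0) < d"
      obtain p q where [simp]: "x = (p, q)" by (cases x)
      have pq: "p \<in> A" "q \<in> A" using x by auto
      have dp: "dist p p0 < d" using x(2) dist_fst_le[of x "(p0, q0)"] by simp
      have dq: "cmod (q - q0) < d" using x(2) dist_snd_le[of x "(p0, q0)"] by (simp add: dist_norm)
      have "2 * cmod (q - q0) / r < e / 2" using dq d(4) r by (simp add: field_simps)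
      with near[of q p] pq dq d have "\<bar>?h q p - ?h q0 p\<bar> < e / 2" by simp
      moreover have "\<bar>?h q0 p - ?h q0 p0\<bar> < e / 2"
        using d1(2)[of p] pq dp d by (simp add: dist_real_def)
      ultimately show "dist ((\<lambda>(p, q). ?h q p) x) (?h q0 p0) < e"
        unfolding dist_real_def by (simp, linarith)
    qed
  qed
  then show ?thesis unfolding continuous_on_iff by auto
qed

section \<open>The annulus\<close>

lemma open_annulus: "open (annulus t)"
  unfolding annulus_def by (intro open_Collect_conj open_Collect_less continuous_intros)

lemma bounded_annulus: "bounded (annulus t)"
  unfolding annulus_def bounded_iff by (intro exI[of _ "exp (2 * t)"]) auto

lemma annulus_nonzero: "p \<in> annulus t \<Longrightarrow> p \<noteq> 0"
  using exp_ge_zero[of "-2 * t"] by (auto simp: annulus_def simp del: exp_ge_zero)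

lemma frontier_annulus_cases:
  assumes "\<xi> \<in> frontier (annulus t)"
  obtains "cmod \<xi> = exp (2 * t)" | "cmod \<xi> = exp (- 2 * t)"
proof -
  have "closed {z. exp (- 2 * t) \<le> cmod z \<and> cmod z \<le> exp (2 * t)}"
    by (intro closed_Collect_conj closed_Collect_le continuous_intros)
  then have "closure (annulus t) \<subseteq> {z. exp (- 2 * t) \<le> cmod z \<and> cmod z \<le> exp (2 * t)}"
    by (rule closure_minimal[rotated]) (auto simp: annulus_def)
  then show thesis
    using assms that open_annulus[of t] by (force simp: frontier_def interior_open annulus_def)
qed

text \<open>
  The bound is uniform in \<open>p\<close>; the hypotheses on \<open>R\<close> only restrict \<open>q\<close> and ask that the boundary
  circles be far from \<open>q\<close> on a multiplicative scale.
\<close>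
theorem annulus_regular_part_estimate:
  assumes t: "t > 0" and G: "negative_green_kernel (annulus t) G"
    and p: "p \<in> annulus t" and q: "q \<in> annulus t"
    and R: "1 / R \<le> cmod q" "cmod q \<le> R" "R * exp (- 2 * t) \<le> 1 / 2"
  shows "\<bar>green_regular_part (annulus t) G q p + t + ln (cmod q) / 2 + ln (cmod p) / 2
      - ln (cmod p) * ln (cmod q) / (4 * t)\<bar> \<le> 2 * R * exp (- 2 * t)"
proof -
  let ?A = "annulus t"
  let ?h = "green_regular_part ?A G q"
  \<comment> \<open>\<open>a + b log |p|\<close> equals \<open>2t\<close> on the outer circle and \<open>log |q|\<close> on the inner one.\<close>
  define a b where "a = t + ln (cmod q) / 2" and "b = 1 / 2 - ln (cmod q) / (4 * t)"
  have q0: "q \<noteq> 0" "cmod q > 0" using annulus_nonzero[OF q] by auto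
  have Rpos: "R > 0" using q0 R by linarith
  have "harmonic_on (\<lambda>z. ln (cmod z)) ?A"
    by (rule harmonic_on_subset[OF harmonic_on_ln_norm open_annulus]) (auto dest: annulus_nonzero)
  from harmonic_on_linear_combination[OF harmonic_on_const[OF open_annulus, of a] this, of 1 b]
  have "harmonic_on (\<lambda>p. a + b * ln (cmod p)) ?A" by simp
  from harmonic_on_linear_combination[OF green_regular_part_harmonic[OF G q] this, of 1 1]
  have "harmonic_on (\<lambda>p. ?h p + (a + b * ln (cmod p))) ?A" by simp
  then have "\<bar>?h p + (a + b * ln (cmod p))\<bar> \<le> 2 * R * exp (- 2 * t)"
  proof (rule harmonic_abs_maximum_principle[OF _ bounded_annulus _ _ p])
    fix \<xi> assume \<xi>: "\<xi> \<in> frontier ?A"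
    have \<xi>0: "\<xi> \<noteq> 0" using \<xi> by (rule frontier_annulus_cases) auto
    show "((\<lambda>p. ?h p + (a + b * ln (cmod p))) \<longlongrightarrow>
        - ln (cmod (\<xi> - q)) + (a + b * ln (cmod \<xi>))) (at \<xi> within ?A)"
      using \<xi>0 by (intro tendsto_intros green_regular_part_boundary[OF G q \<xi>]) auto
    from \<xi> show "\<bar>- ln (cmod (\<xi> - q)) + (a + b * ln (cmod \<xi>))\<bar> \<le> 2 * R * exp (- 2 * t)"
    proof (rule frontier_annulus_cases)
      assume c: "cmod \<xi> = exp (2 * t)"
      have le: "cmod q / cmod \<xi> \<le> R * exp (- 2 * t)"
        using R by (simp add: c exp_minus field_simps)
      then have "cmod q / cmod \<xi> \<le> 1 / 2" using R(3) by linarith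
      then have "cmod q \<le> cmod \<xi> / 2" using \<xi>0 by (simp add: field_simps)
      from abs_ln_norm_diff_le[OF \<xi>0 this] le
      have "\<bar>ln (cmod (\<xi> - q)) - 2 * t\<bar> \<le> 2 * R * exp (- 2 * t)" by (simp add: c)
      moreover have "a + b * ln (cmod \<xi>) = 2 * t" using t by (simp add: a_def b_def c field_simps)
      ultimately show ?thesis by simp
    next
      assume c: "cmod \<xi> = exp (- 2 * t)"
      have "1 / cmod q \<le> R" using R q0 Rpos by (simp add: field_simps)
      then have "1 / cmod q * cmod \<xi> \<le> R * exp (- 2 * t)"
        unfolding c by (rule mult_right_mono) simp
      then have le: "cmod \<xi> / cmod q \<le> R * exp (- 2 * t)" by simp
      then have "cmod \<xi> / cmod q \<le> 1 / 2" using R(3) by linarith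
      then have "cmod \<xi> \<le> cmod q / 2" using q0 by (simp add: field_simps)
      from abs_ln_norm_diff_le[OF q0(1) this] le
      have "\<bar>ln (cmod (\<xi> - q)) - ln (cmod q)\<bar> \<le> 2 * R * exp (- 2 * t)"
        by (simp add: norm_minus_commute)
      moreover have "a + b * ln (cmod \<xi>) = ln (cmod q)" using t by (simp add: a_def b_def c field_simps)
      ultimately show ?thesis by simp
    qed
  qed
  then show ?thesis using t by (simp add: a_def b_def algebra_simps)
qed

section \<open>The limit\<close>

lemma compact_nonzero_bounds:
  assumes "compact K" "K \<subseteq> (UNIV - {0}) \<times> (UNIV - {0::complex})"
  obtains R where "R > 1" "\<And>p q. (p, q) \<in> K \<Longrightarrow>
    1 / R \<le> cmod p \<and> cmod p \<le> R \<and> 1 / R \<le> cmod q \<and> cmod q \<le> R"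
proof -
  let ?f = "\<lambda>x. cmod (fst x) + 1 / cmod (fst x) + cmod (snd x) + 1 / cmod (snd x)"
  have "compact (?f ` K)"
    using assms by (intro compact_continuous_image continuous_intros) auto
  then have "bounded (?f ` K)" by (rule compact_imp_bounded)
  then obtain B where B: "B > 0" "\<forall>y\<in>?f ` K. norm y \<le> B"
    unfolding bounded_pos by (elim exE conjE)
  show thesis
  proof (rule that[of "B + 1"])
    show "B + 1 > 1" using B(1) by simp
    fix p q assume pq: "(p, q) \<in> K"
    then have nz: "cmod p > 0" "cmod q > 0" using assms(2) by auto
    then have pos: "1 / cmod p > 0" "1 / cmod q > 0" by auto
    have "cmod p + 1 / cmod p + cmod q + 1 / cmod q \<le> B"
      using bspec[OF B(2) imageI[OF pq]] by simp
    then have "cmod p \<le> B + 1" "cmod q \<le> B + 1" "1 / cmod p \<le> B + 1" "1 / cmod q \<le> B + 1"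
      using nz pos by linarith+
    then show "1 / (B + 1) \<le> cmod p \<and> cmod p \<le> B + 1 \<and> 1 / (B + 1) \<le> cmod q \<and> cmod q \<le> B + 1"
      using nz B(1) by (simp add: pos_divide_le_eq mult.commute)
  qed
qed

theorem theorem1p4:
  fixes G :: "real \<Rightarrow> complex \<Rightarrow> complex \<Rightarrow> real"
  assumes "\<And>t. t > 0 \<Longrightarrow> negative_green_kernel (annulus t) (G t)"
  shows "\<exists>D :: real \<Rightarrow> complex \<times> complex \<Rightarrow> real.
    (\<forall>t>0. continuous_on (annulus t \<times> annulus t) (D t) \<and>
       (\<forall>p\<in>annulus t. \<forall>q\<in>annulus t. p \<noteq> q \<longrightarrow>
          D t (p, q) = (G t p q + ln (exp t - exp (- t))) - ln (cmod (p - q) / sqrt (cmod (p * q))))) \<and>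
    (\<forall>K. compact K \<and> K \<subseteq> (UNIV - {0}) \<times> (UNIV - {0}) \<longrightarrow>
       uniform_limit K D (\<lambda>_. 0) at_top)"
proof -
  define h where "h = (\<lambda>t. green_regular_part (annulus t) (G t))"
  define D where "D = (\<lambda>t x. (\<lambda>(p, q). h t q p) x + ln (exp t - exp (- t))
    + ln (cmod (fst x)) / 2 + ln (cmod (snd x)) / 2)"
  have "continuous_on (annulus t \<times> annulus t) (D t)" if "t > 0" for t
    unfolding D_def h_def
    by (intro continuous_intros green_regular_part_continuous assms that bounded_annulus)
      (auto dest: annulus_nonzero)
  moreover have "D t (p, q) = (G t p q + ln (exp t - exp (- t))) - ln (cmod (p - q) / sqrt (cmod (p * q)))"
    if t: "t > 0" and p: "p \<in> annulus t" and q: "q \<in> annulus t" and ne: "p \<noteq> q" for t p q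
  proof -
    have "p \<noteq> 0" "q \<noteq> 0" using p q annulus_nonzero by auto
    then have "ln (cmod (p - q) / sqrt (cmod (p * q))) = ln (cmod (p - q)) - (ln (cmod p) / 2 + ln (cmod q) / 2)"
      using ne by (simp add: ln_div ln_sqrt norm_mult ln_mult real_sqrt_mult)
    then show ?thesis
      using green_regular_part_eq[OF assms[OF t] q p ne] by (simp add: D_def h_def)
  qed
  moreover have "uniform_limit K D (\<lambda>_. 0) at_top"
    if K: "compact K" "K \<subseteq> (UNIV - {0}) \<times> (UNIV - {0})" for K
  proof -
    obtain R where R: "R > 1" "\<And>p q. (p, q) \<in> K \<Longrightarrow>
        1 / R \<le> cmod p \<and> cmod p \<le> R \<and> 1 / R \<le> cmod q \<and> cmod q \<le> R"
      using compact_nonzero_bounds[OF K] by blast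
    \<comment> \<open>\<open>B t\<close> collects the boundary error, the error of \<open>log (exp t - exp (- t)) \<approx> t\<close>, and the bound
      for \<open>log |p| log |q| / (4t)\<close> on \<open>K\<close>.\<close>
    define L where "L = ln R"
    define B where "B = (\<lambda>t. 2 * R * exp (- 2 * t) + \<bar>ln (exp t - exp (- t)) - t\<bar> + L\<^sup>2 / (4 * t))"
    have "(B \<longlongrightarrow> 0) at_top"
    proof -
      have "((\<lambda>t. 2 * R * exp (- 2 * t)) \<longlongrightarrow> 0) at_top" by real_asymp
      moreover have "((\<lambda>t::real. ln (exp t - exp (- t)) - t) \<longlongrightarrow> 0) at_top" by real_asymp
      then have "((\<lambda>t::real. \<bar>ln (exp t - exp (- t)) - t\<bar>) \<longlongrightarrow> 0) at_top"
        by (rule tendsto_rabs_zero)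
      moreover have "((\<lambda>t. L\<^sup>2 / (4 * t)) \<longlongrightarrow> 0) at_top" by real_asymp
      ultimately show ?thesis unfolding B_def by (intro tendsto_add_zero)
    qed
    have small: "\<forall>\<^sub>F t in at_top. R * exp (- 2 * t) < 1 / 2"
    proof -
      have "((\<lambda>t. R * exp (- 2 * t)) \<longlongrightarrow> 0) at_top" by real_asymp
      then show ?thesis by (rule order_tendstoD) simp
    qed
    have bound: "\<bar>D t (p, q)\<bar> \<le> B t" if t: "t > 0" "R * exp (- 2 * t) < 1 / 2" and pq: "(p, q) \<in> K" for t p q
    proof -
      have "R * 2 < exp (2 * t)" using t(2) by (simp add: exp_minus field_simps)
      then have Re: "R < exp (2 * t)" using R(1) by linarith
      then have "exp (- 2 * t) < 1 / R" using R(1) by (simp add: exp_minus field_simps)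
      then have A: "p \<in> annulus t" "q \<in> annulus t"
        using R(2)[OF pq] Re by (auto simp: annulus_def)
      have lnle: "\<bar>ln (cmod z)\<bar> \<le> L" if "1 / R \<le> cmod z" "cmod z \<le> R" for z
      proof -
        have z: "cmod z > 0" using that(1) R(1) by (smt (verit) divide_pos_pos)
        then have "ln (1 / R) \<le> ln (cmod z)" using that(1) R(1) by (subst ln_le_cancel_iff) auto
        moreover have "ln (cmod z) \<le> ln R" using z that(2) R(1) by (subst ln_le_cancel_iff) auto
        ultimately show ?thesis using R(1) by (simp add: L_def ln_div)
      qed
      have "\<bar>ln (cmod p) * ln (cmod q)\<bar> \<le> L * L"
        unfolding abs_mult using lnle R(2)[OF pq] by (intro mult_mono) (auto intro: order_trans[OF abs_ge_zero])
      then have "\<bar>ln (cmod p) * ln (cmod q) / (4 * t)\<bar> \<le> L\<^sup>2 / (4 * t)"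
        using t by (simp add: power2_eq_square divide_right_mono)
      moreover have "\<bar>h t q p + t + ln (cmod q) / 2 + ln (cmod p) / 2
          - ln (cmod p) * ln (cmod q) / (4 * t)\<bar> \<le> 2 * R * exp (- 2 * t)"
        unfolding h_def using R(2)[OF pq] t
        by (intro annulus_regular_part_estimate assms A) auto
      ultimately show ?thesis unfolding D_def B_def fst_conv snd_conv prod.case by linarith
    qed
    show ?thesis
    proof (rule uniform_limitI)
      fix e :: real assume "e > 0"
      then have "\<forall>\<^sub>F t in at_top. B t < e" using \<open>(B \<longlongrightarrow> 0) at_top\<close> by (intro order_tendstoD)
      with small eventually_gt_at_top[of 0]
      show "\<forall>\<^sub>F t in at_top. \<forall>x\<in>K. dist (D t x) 0 < e"
      proof eventually_elim
        case (elim t)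
        show ?case
        proof safe
          fix p q assume "(p, q) \<in> K"
          then show "dist (D t (p, q)) 0 < e" using bound[of t p q] elim by simp
        qed
      qed
    qed
  qed
  ultimately show ?thesis by (intro exI[of _ D]) blast
qed

end
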